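(* Let $\Phi:X\to Y$ be a smooth diffeomorphism between open subsets $X,Y\subset\mathbb{R}^n$. If $u:Y\to\mathbb{R}$ is locally semiconvex, then $u\circ\Phi:X\to\mathbb{R}$ is locally semiconvex.
   Context: A function $u$ on an open set $Y\subset\mathbb{R}^n$ is locally semiconvex if every $y\in Y$ belongs to some ball $B\subset Y$ such that $u+\frac{\lambda}{2}|\cdot|^2$ is convex on $B$ for some $\lambda=\lambda(y)\geq0$. *)

theory Defs
  imports "HOL-Analysis.Analysis"
begin

text \<open>
  Smoothness on an open set \<open>S\<close>. \<open>C_k_on k f S\<close> says that \<open>f\<close> is of class \<open>C\<^sup>k\<close> on \<open>S\<close>:
  continuous if \<open>k = 0\<close>, otherwise Frechet differentiable at every point of \<open>S\<close> and, for every fixed direction \<open>v\<close>,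
  the map \<open>x \<mapsto> Df(x)v\<close> is of class \<open>C\<^bsup>k-1\<^esup>\<close>. As the space is finite-dimensional, this is the usual
  notion. The derivatives are full ones (\<open>at x\<close>, not \<open>at x within S\<close>), so
  the definition is only meant for open \<open>S\<close>, and then depends only on the values of \<open>f\<close> on \<open>S\<close>.
\<close>

primrec C_k_on :: "nat \<Rightarrow> ('a::euclidean_space \<Rightarrow> 'b::euclidean_space) \<Rightarrow> 'a set \<Rightarrow> bool" where
  "C_k_on 0 f S \<longleftrightarrow> continuous_on S f"
| "C_k_on (Suc k) f S \<longleftrightarrow>
     (\<forall>x\<in>S. f differentiable (at x)) \<and>
     (\<forall>v. C_k_on k (\<lambda>x. frechet_derivative f (at x) v) S)"

definition smooth_on :: "('a::euclidean_space \<Rightarrow> 'b::euclidean_space) \<Rightarrow> 'a set \<Rightarrow> bool" where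
  "smooth_on f S \<longleftrightarrow> (\<forall>k. C_k_on k f S)"

definition smooth_diffeomorphism ::
    "'a::euclidean_space set \<Rightarrow> 'b::euclidean_space set \<Rightarrow> ('a \<Rightarrow> 'b) \<Rightarrow> bool" where
  "smooth_diffeomorphism X Y \<Phi> \<longleftrightarrow>
     bij_betw \<Phi> X Y \<and> smooth_on \<Phi> X \<and> smooth_on (inv_into X \<Phi>) Y"

text \<open>The ball has to contain \<open>y\<close> but need not be centred at \<open>y\<close>.\<close>

definition locally_semiconvex_on ::
    "'a::euclidean_space set \<Rightarrow> ('a \<Rightarrow> real) \<Rightarrow> bool" where
  "locally_semiconvex_on Y u \<longleftrightarrow>
     (\<forall>y\<in>Y. \<exists>c r. y \<in> ball c r \<and> ball c r \<subseteq> Y \<and>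
        (\<exists>\<kappa>\<ge>0. convex_on (ball c r) (\<lambda>x. u x + \<kappa> / 2 * (norm x)\<^sup>2)))"

end

theory Submission
  imports Defs
begin

text \<open>
  Adding \<open>\<kappa> / 2 * (norm x)\<^sup>2\<close> makes \<open>u\<close> convex exactly when the chord inequality for \<open>u\<close> holds up
  to the error \<open>\<kappa> / 2 * (t * (1 - t) * (norm (x - y))\<^sup>2)\<close> (lemma \<open>convex_on_add_norm_sq_iff\<close>).
  In this form semiconvexity no longer refers to an origin, and it can be followed through a
  change of variables \<open>f\<close>.

  Let \<open>z = (1 - t) *\<^sub>R x + t *\<^sub>R y\<close>. As \<open>f\<close> is of class \<open>C\<^sup>2\<close>, it is affine up to second order: \<open>f z\<close>
  differs from the point \<open>q = (1 - t) *\<^sub>R f x + t *\<^sub>R f y\<close> of the chord by at most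
  \<open>K * (t * (1 - t) * (norm (x - y))\<^sup>2)\<close> (lemma \<open>C2_convex_combination_defect\<close>). A semiconvex
  function is locally Lipschitz, being the difference of a convex function and a quadratic one
  (lemma \<open>semiconvex_imp_locally_lipschitz\<close>), so replacing \<open>u (f z)\<close> by \<open>u q\<close> costs an error of
  the same form. The semiconvexity of \<open>u\<close> bounds \<open>u q\<close> by the chord of \<open>u \<circ> f\<close> plus a multiple of
  \<open>t * (1 - t) * (norm (f x - f y))\<^sup>2\<close>, and the Lipschitz bound on \<open>f\<close> turns this into the required
  form as well. With Lipschitz constants \<open>L\<close> of \<open>u\<close> and \<open>M\<close> of \<open>f\<close>, the new semiconvexity constant
  is \<open>2 * L * K + \<kappa> * M\<^sup>2\<close>.
\<close>

section \<open>Semiconvexity as a chord inequality\<close>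

lemma norm_sq_convex_combination:
  fixes x y :: "'a::real_inner"
  shows "(norm ((1 - t) *\<^sub>R x + t *\<^sub>R y))\<^sup>2 =
    (1 - t) * (norm x)\<^sup>2 + t * (norm y)\<^sup>2 - t * (1 - t) * (norm (x - y))\<^sup>2"
  unfolding power2_norm_eq_inner
  by (simp add: inner_add_left inner_add_right inner_diff_left inner_diff_right
      inner_commute algebra_simps)

text \<open>
  The quadratic \<open>(norm x)\<^sup>2\<close> has the chord defect \<open>t * (1 - t) * (norm (x - y))\<^sup>2\<close> exactly, by the
  preceding identity; hence an equivalence with no loss in the constant.
\<close>

lemma convex_on_add_norm_sq_iff:
  fixes u :: "'a::real_inner \<Rightarrow> real"
  shows "convex_on S (\<lambda>x. u x + \<kappa> / 2 * (norm x)\<^sup>2) \<longleftrightarrow>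
    convex S \<and> (\<forall>x\<in>S. \<forall>y\<in>S. \<forall>t. 0 \<le> t \<longrightarrow> t \<le> 1 \<longrightarrow>
      u ((1 - t) *\<^sub>R x + t *\<^sub>R y) \<le>
        (1 - t) * u x + t * u y + \<kappa> / 2 * (t * (1 - t) * (norm (x - y))\<^sup>2))"
    (is "convex_on S ?g \<longleftrightarrow> ?R")
proof -
  have *: "?g ((1 - t) *\<^sub>R x + t *\<^sub>R y) \<le> (1 - t) * ?g x + t * ?g y \<longleftrightarrow>
      u ((1 - t) *\<^sub>R x + t *\<^sub>R y) \<le>
        (1 - t) * u x + t * u y + \<kappa> / 2 * (t * (1 - t) * (norm (x - y))\<^sup>2)" for x y t
    unfolding norm_sq_convex_combination
    by (simp add: algebra_simps add_divide_distrib diff_divide_distrib)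
  show ?thesis
  proof
    assume "convex_on S ?g"
    then show ?R
      using convex_onD[of S ?g] convex_on_imp_convex[of S ?g] unfolding * by blast
  next
    assume R: ?R
    show "convex_on S ?g"
    proof (rule convex_onI)
      fix t :: real and x y
      assume "t > 0" "t < 1" "x \<in> S" "y \<in> S"
      then show "?g ((1 - t) *\<^sub>R x + t *\<^sub>R y) \<le> (1 - t) * ?g x + t * ?g y"
        unfolding * using R by auto
    qed (use R in blast)
  qed
qed

section \<open>Local Lipschitz continuity of semiconvex functions\<close>

text \<open>
  Prolong the segment from \<open>x\<close> to \<open>y\<close> by the length \<open>r\<close>, which stays inside the larger ball. The
  slope of \<open>g\<close> from \<open>x\<close> to \<open>y\<close> is at most the slope from \<open>x\<close> to the new endpoint, a quotient of an
  oscillation of at most \<open>2 * b\<close> by a length of at least \<open>r\<close>.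
\<close>

lemma bounded_convex_imp_lipschitz:
  fixes g :: "'a::real_normed_vector \<Rightarrow> real"
  assumes g: "convex_on (ball a (2 * r)) g" and r: "r > 0"
    and b: "\<And>x. x \<in> ball a (2 * r) \<Longrightarrow> \<bar>g x\<bar> \<le> b"
  shows "(2 * b / r)-lipschitz_on (ball a r) g"
proof (rule lipschitz_onI)
  have b0: "b \<ge> 0"
    using b[of a] r by auto
  then show "0 \<le> 2 * b / r"
    using r by simp
  have *: "g y - g x \<le> 2 * b / r * norm (y - x)"
    if x: "x \<in> ball a r" and y: "y \<in> ball a r" for x y
  proof (cases "y = x")
    case False
    define d where "d = norm (y - x)"
    have d: "d > 0"
      using False by (simp add: d_def)
    define z where "z = y + (r / d) *\<^sub>R (y - x)"
    \<comment> \<open>the parameter at which the segment from \<open>x\<close> to \<open>z\<close> passes through \<open>y\<close>\<close>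
    define s where "s = d / (r + d)"
    have s: "0 \<le> s" "s \<le> 1"
      using d r by (auto simp: s_def field_simps)
    have "dist y z = r"
      using d r by (simp add: z_def dist_norm d_def)
    then have z: "z \<in> ball a (2 * r)"
      using y dist_triangle[of a z y] by simp
    have x': "x \<in> ball a (2 * r)"
      using x r by simp
    have "1 + r / d = (r + d) / d"
      using d by (simp add: field_simps)
    then have "s * (1 + r / d) = 1"
      using d r by (simp add: s_def)
    moreover have "(1 - s) *\<^sub>R x + s *\<^sub>R z = x + (s * (1 + r / d)) *\<^sub>R (y - x)"
      by (simp add: z_def algebra_simps)
    ultimately have "(1 - s) *\<^sub>R x + s *\<^sub>R z = y"
      by simp
    then have "g y \<le> (1 - s) * g x + s * g z"
      using convex_onD[OF g s x' z] by simp
    then have "g y - g x \<le> s * (g z - g x)"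
      by (simp add: algebra_simps)
    also have "\<dots> \<le> s * (2 * b)"
      using b[OF x'] b[OF z] s by (intro mult_left_mono) auto
    also have "\<dots> \<le> d / r * (2 * b)"
      using d r b0 by (intro mult_right_mono) (auto simp: s_def field_simps)
    finally show ?thesis
      by (simp add: d_def mult_ac)
  qed simp
  show "dist (g x) (g y) \<le> 2 * b / r * dist x y"
    if "x \<in> ball a r" "y \<in> ball a r" for x y
    using *[OF that] *[OF that(2,1)] by (simp add: dist_norm norm_minus_commute abs_le_iff)
qed

lemma convex_on_imp_locally_lipschitz:
  fixes g :: "'a::euclidean_space \<Rightarrow> real"
  assumes "open S" "convex_on S g" "a \<in> S"
  obtains r L where "r > 0" "ball a r \<subseteq> S" "L-lipschitz_on (ball a r) g"
proof -
  obtain e where e: "e > 0" "cball a e \<subseteq> S"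
    using assms open_contains_cball by blast
  have "compact (g ` cball a e)"
    using convex_on_continuous[OF assms(1,2)] e
    by (intro compact_continuous_image) (auto intro: continuous_on_subset)
  then obtain b where b: "\<And>x. x \<in> cball a e \<Longrightarrow> \<bar>g x\<bar> \<le> b"
    by (metis bounded_real compact_imp_bounded image_eqI)
  have "convex_on (ball a (2 * (e / 2))) g"
    by (rule convex_on_subset[OF assms(2)]) (use e in auto)
  then have "(2 * b / (e / 2))-lipschitz_on (ball a (e / 2)) g"
    using e b by (intro bounded_convex_imp_lipschitz) auto
  with e show thesis
    by (intro that[of "e / 2"]) auto
qed

lemma norm_sq_lipschitz_on_ball:
  fixes a :: "'a::real_normed_vector"
  assumes "r > 0"
  shows "(2 * (norm a + r))-lipschitz_on (ball a r) (\<lambda>x. (norm x)\<^sup>2)"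
proof (rule lipschitz_onI)
  fix x y
  assume xy: "x \<in> ball a r" "y \<in> ball a r"
  have n: "norm z \<le> norm a + r" if "z \<in> ball a r" for z
    using that norm_triangle_ineq2[of z a] by (simp add: dist_norm norm_minus_commute)
  have "dist ((norm x)\<^sup>2) ((norm y)\<^sup>2) = (norm x + norm y) * \<bar>norm x - norm y\<bar>"
    by (simp add: dist_real_def power2_eq_square square_diff_square_factored abs_mult)
  also have "\<dots> \<le> (2 * (norm a + r)) * dist x y"
    using n[OF xy(1)] n[OF xy(2)] norm_triangle_ineq3[of x y] assms
    by (intro mult_mono) (auto simp: dist_norm)
  finally show "dist ((norm x)\<^sup>2) ((norm y)\<^sup>2) \<le> 2 * (norm a + r) * dist x y" .
qed (use assms in auto)

lemma semiconvex_imp_locally_lipschitz: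
  fixes u :: "'a::euclidean_space \<Rightarrow> real"
  assumes "open S" "convex_on S (\<lambda>x. u x + \<kappa> / 2 * (norm x)\<^sup>2)" "a \<in> S"
  obtains r L where "r > 0" "ball a r \<subseteq> S" "L-lipschitz_on (ball a r) u"
proof -
  let ?g = "\<lambda>x. u x + \<kappa> / 2 * (norm x)\<^sup>2"
  obtain r L where r: "r > 0" "ball a r \<subseteq> S" and L: "L-lipschitz_on (ball a r) ?g"
    using convex_on_imp_locally_lipschitz[OF assms] .
  obtain M where "M-lipschitz_on (ball a r) (\<lambda>x. \<kappa> / 2 * (norm x)\<^sup>2)"
    using lipschitz_on_cmult_real[OF norm_sq_lipschitz_on_ball[OF r(1)]] by blast
  from lipschitz_on_diff[OF L this] have "(L + M)-lipschitz_on (ball a r) u"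
    by simp
  with r show thesis
    by (rule that)
qed

section \<open>Second-order estimates for maps of class \<open>C\<^sup>2\<close>\<close>

text \<open>
  Smoothness is expressed through derivatives in one fixed direction at a time. This bound turns
  directional estimates into estimates of the operator norm of the whole derivative.
\<close>

lemma onorm_le_sum_Basis:
  fixes A :: "'a::euclidean_space \<Rightarrow> 'b::real_normed_vector"
  assumes "linear A" and M: "\<And>b. b \<in> Basis \<Longrightarrow> norm (A b) \<le> M b"
  shows "onorm A \<le> (\<Sum>b\<in>Basis. M b)"
proof (rule onorm_le)
  fix v
  have "norm (A v) = norm (\<Sum>b\<in>Basis. (v \<bullet> b) *\<^sub>R A b)"
    by (subst euclidean_representation[of v, symmetric])
      (simp add: linear_sum[OF assms(1)] linear_cmul[OF assms(1)])
  also have "\<dots> \<le> (\<Sum>b\<in>Basis. \<bar>v \<bullet> b\<bar> * norm (A b))"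
    by (rule sum_norm_le) simp
  also have "\<dots> \<le> (\<Sum>b\<in>Basis. norm v * M b)"
    by (intro sum_mono mult_mono M Basis_le_norm) auto
  also have "\<dots> = (\<Sum>b\<in>Basis. M b) * norm v"
    by (simp add: sum_distrib_left mult_ac)
  finally show "norm (A v) \<le> (\<Sum>b\<in>Basis. M b) * norm v" .
qed

lemma C1_imp_lipschitz_on_cball:
  fixes f :: "'a::euclidean_space \<Rightarrow> 'b::euclidean_space"
  assumes "C_k_on (Suc 0) f S" "cball a r \<subseteq> S"
  obtains M where "M-lipschitz_on (cball a r) f"
proof -
  let ?D = "\<lambda>x. frechet_derivative f (at x)"
  have D: "(f has_derivative ?D x) (at x)" if "x \<in> S" for x
    using assms(1) that by (simp add: frechet_derivative_works)
  have "\<exists>B. \<forall>x\<in>cball a r. norm (?D x v) \<le> B" for v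
  proof -
    have "continuous_on (cball a r) (\<lambda>x. ?D x v)"
      using assms by (auto intro: continuous_on_subset)
    then have "bounded ((\<lambda>x. ?D x v) ` cball a r)"
      by (intro compact_imp_bounded compact_continuous_image) auto
    then show ?thesis
      by (auto simp: bounded_iff)
  qed
  then obtain B where B: "\<And>v x. x \<in> cball a r \<Longrightarrow> norm (?D x v) \<le> B v"
    by metis
  let ?M = "\<Sum>b\<in>Basis. B b"
  have "onorm (?D x) \<le> ?M" if "x \<in> cball a r" for x
    using that assms(2) B
    by (intro onorm_le_sum_Basis has_derivative_linear[OF D]) auto
  \<comment> \<open>The absolute value makes the constant nonnegative if \<open>r < 0\<close>, where the \<open>B b\<close> are arbitrary.\<close>
  then have "onorm (?D x) \<le> \<bar>?M\<bar>" if "x \<in> cball a r" for x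
    using that by (meson abs_ge_self order_trans)
  then have "\<bar>?M\<bar>-lipschitz_on (cball a r) f"
    using assms(2)
    by (intro bounded_derivative_imp_lipschitz[where f' = ?D] has_derivative_at_withinI[OF D]) auto
  then show thesis
    by (rule that)
qed

lemma C2_imp_C1:
  assumes "C_k_on (Suc (Suc 0)) f S"
  shows "C_k_on (Suc 0) f S"
proof -
  have "continuous_on S (\<lambda>x. frechet_derivative f (at x) v)" for v
  proof -
    have "\<forall>x\<in>S. (\<lambda>x. frechet_derivative f (at x) v) differentiable at x"
      using assms by simp
    then show ?thesis
      by (meson continuous_at_imp_continuous_on differentiable_imp_continuous_within)
  qed
  with assms show ?thesis
    by simp
qed

text \<open>
  Expand \<open>f\<close> to first order around the intermediate point \<open>z\<close>. In the convex combination of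
  \<open>f x\<close> and \<open>f y\<close> the linear terms cancel, since the weighted mean of \<open>x - z\<close> and \<open>y - z\<close> is zero. The remainders
  are at most \<open>K * (norm (x - z))\<^sup>2\<close> and \<open>K * (norm (y - z))\<^sup>2\<close>, where \<open>K\<close> is a Lipschitz constant of
  the derivative. The distances are \<open>t * norm (x - y)\<close> and \<open>(1 - t) * norm (x - y)\<close>, so the weights
  combine to \<open>(1 - t) * t\<^sup>2 + t * (1 - t)\<^sup>2 = t * (1 - t)\<close>. The factor \<open>t * (1 - t)\<close> matters: it is
  what a quadratic correction can absorb.
\<close>

lemma C2_convex_combination_defect:
  fixes f :: "'a::euclidean_space \<Rightarrow> 'b::euclidean_space"
  assumes "C_k_on (Suc (Suc 0)) f S" "cball a r \<subseteq> S"
  obtains K where "K \<ge> 0"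
    "\<And>x y t. x \<in> cball a r \<Longrightarrow> y \<in> cball a r \<Longrightarrow> 0 \<le> t \<Longrightarrow> t \<le> 1 \<Longrightarrow>
      norm (f ((1 - t) *\<^sub>R x + t *\<^sub>R y) - ((1 - t) *\<^sub>R f x + t *\<^sub>R f y))
        \<le> K * (t * (1 - t) * (norm (x - y))\<^sup>2)"
proof -
  let ?D = "\<lambda>x. frechet_derivative f (at x)"
  have D: "(f has_derivative ?D x) (at x)" if "x \<in> cball a r" for x
    using assms that by (auto simp: frechet_derivative_works)
  have lin: "linear (?D x)" if "x \<in> cball a r" for x
    using D[OF that] by (rule has_derivative_linear)
  have "\<exists>M. M-lipschitz_on (cball a r) (\<lambda>x. ?D x v)" for v
  proof -
    have "C_k_on (Suc 0) (\<lambda>x. ?D x v) S"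
      using assms(1) unfolding C_k_on.simps(2)[of "Suc 0"] by blast
    from C1_imp_lipschitz_on_cball[OF this assms(2)] show ?thesis
      by blast
  qed
  then obtain M where M: "\<And>v. (M v)-lipschitz_on (cball a r) (\<lambda>x. ?D x v)"
    by metis
  define K where "K = (\<Sum>b\<in>Basis. M b)"
  have K0: "K \<ge> 0"
    unfolding K_def using M by (intro sum_nonneg) (auto intro: lipschitz_on_nonneg)
  have onorm_le: "onorm (\<lambda>v. ?D x v - ?D z v) \<le> K * norm (x - z)"
    if "x \<in> cball a r" "z \<in> cball a r" for x z
    unfolding K_def sum_distrib_right
    using that lipschitz_on_normD[OF M that]
    by (intro onorm_le_sum_Basis linear_compose_sub lin) auto
  have taylor: "norm (f x - f z - ?D z (x - z)) \<le> K * (norm (x - z))\<^sup>2"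
    if x: "x \<in> cball a r" and z: "z \<in> cball a r" for x z
  proof -
    have sub: "closed_segment z x \<subseteq> cball a r"
      using x z by (simp add: closed_segment_subset)
    \<comment> \<open>Mean value inequality for \<open>f\<close> minus its linear part at \<open>z\<close>; on the segment from \<open>z\<close> to \<open>x\<close> the
      derivative of this difference has norm at most \<open>K * norm (x - z)\<close>.\<close>
    have "norm ((\<lambda>w. f w - ?D z w) x - (\<lambda>w. f w - ?D z w) z) \<le> K * norm (x - z) * norm (x - z)"
    proof (rule differentiable_bound[where S = "closed_segment z x"
          and f' = "\<lambda>w v. ?D w v - ?D z v"])
      fix w assume w: "w \<in> closed_segment z x"
      then have "w \<in> cball a r" using sub by blast
      then show "((\<lambda>w. f w - ?D z w) has_derivative (\<lambda>v. ?D w v - ?D z v))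
          (at w within closed_segment z x)"
        by (intro has_derivative_diff has_derivative_at_withinI[OF D]
            linear_imp_has_derivative[OF lin[OF z]])
      have "onorm (\<lambda>v. ?D w v - ?D z v) \<le> K * norm (w - z)"
        using \<open>w \<in> cball a r\<close> z by (rule onorm_le)
      also have "\<dots> \<le> K * norm (x - z)"
        using segment_bound1[OF w] K0 by (intro mult_left_mono) auto
      finally show "onorm (\<lambda>v. ?D w v - ?D z v) \<le> K * norm (x - z)" .
    qed auto
    then show ?thesis
      by (simp add: linear_diff[OF lin[OF z]] power2_eq_square algebra_simps)
  qed
  show thesis
  proof (rule that[OF K0])
    fix x y :: 'a and t :: real
    assume x: "x \<in> cball a r" and y: "y \<in> cball a r" and t: "0 \<le> t" "t \<le> 1"
    define z where "z = (1 - t) *\<^sub>R x + t *\<^sub>R y"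
    have z: "z \<in> cball a r"
      unfolding z_def using convexD_alt[OF convex_cball x y t] .
    have xz: "x - z = t *\<^sub>R (x - y)" and yz: "y - z = - ((1 - t) *\<^sub>R (x - y))"
      by (simp_all add: z_def algebra_simps)
    define R where "R w = f w - f z - ?D z (w - z)" for w
    have "(1 - t) *\<^sub>R ?D z (x - z) + t *\<^sub>R ?D z (y - z) = 0"
      unfolding xz yz linear_neg[OF lin[OF z]] linear_cmul[OF lin[OF z]]
      by (simp add: algebra_simps)
    then have "f z - ((1 - t) *\<^sub>R f x + t *\<^sub>R f y) = - ((1 - t) *\<^sub>R R x + t *\<^sub>R R y)"
      unfolding R_def by (simp add: algebra_simps)
    then have "norm (f z - ((1 - t) *\<^sub>R f x + t *\<^sub>R f y)) = norm ((1 - t) *\<^sub>R R x + t *\<^sub>R R y)"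
      by (metis norm_minus_cancel)
    also have "\<dots> \<le> (1 - t) * norm (R x) + t * norm (R y)"
      using norm_triangle_ineq[of "(1 - t) *\<^sub>R R x" "t *\<^sub>R R y"] t by simp
    also have "\<dots> \<le> (1 - t) * (K * (norm (x - z))\<^sup>2) + t * (K * (norm (y - z))\<^sup>2)"
      unfolding R_def using t taylor[OF x z] taylor[OF y z]
      by (intro add_mono mult_left_mono) auto
    also have "\<dots> = K * (t * (1 - t) * (norm (x - y))\<^sup>2)"
      unfolding xz yz norm_minus_cancel norm_scaleR power_mult_distrib power2_abs
      by (simp add: power2_eq_square algebra_simps)
    finally show "norm (f ((1 - t) *\<^sub>R x + t *\<^sub>R y) - ((1 - t) *\<^sub>R f x + t *\<^sub>R f y))
        \<le> K * (t * (1 - t) * (norm (x - y))\<^sup>2)"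
      unfolding z_def .
  qed
qed

section \<open>Composition\<close>

text \<open>
  Around a given point, take a ball so small that \<open>f\<close> maps it into a ball on which \<open>u\<close> is Lipschitz
  and satisfies its chord inequality; balls being convex, the points \<open>q\<close> of the chords lie there too.
\<close>

lemma locally_semiconvex_on_compose_C2:
  fixes f :: "'a::euclidean_space \<Rightarrow> 'b::euclidean_space" and u :: "'b \<Rightarrow> real"
  assumes X: "open X" and f: "C_k_on (Suc (Suc 0)) f X" "f ` X \<subseteq> Y"
    and u: "locally_semiconvex_on Y u"
  shows "locally_semiconvex_on X (u \<circ> f)"
  unfolding locally_semiconvex_on_def
proof
  fix a assume a: "a \<in> X"
  then have "f a \<in> Y"
    using f(2) by blast
  then obtain c r \<kappa> where fa: "f a \<in> ball c r" and \<kappa>: "\<kappa> \<ge> 0"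
    and conv: "convex_on (ball c r) (\<lambda>x. u x + \<kappa> / 2 * (norm x)\<^sup>2)"
    using u unfolding locally_semiconvex_on_def by meson
  obtain s L where s: "s > 0" "ball (f a) s \<subseteq> ball c r" and L: "L-lipschitz_on (ball (f a) s) u"
    using semiconvex_imp_locally_lipschitz[OF open_ball conv fa] .
  note L0 = lipschitz_on_nonneg[OF L]
  have "isCont f a"
    using f(1) a by (simp add: differentiable_imp_continuous_within)
  then obtain d where d: "d > 0" "\<And>x. dist x a < d \<Longrightarrow> dist (f x) (f a) < s"
    using s(1) unfolding continuous_at_eps_delta by metis
  obtain e where e: "e > 0" "cball a e \<subseteq> X"
    using X a open_contains_cball by blast
  define \<rho> where "\<rho> = min d e"
  have \<rho>: "\<rho> > 0" "ball a \<rho> \<subseteq> cball a e"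
    using d e by (auto simp: \<rho>_def)
  have f_ball: "f x \<in> ball (f a) s" if "x \<in> ball a \<rho>" for x
    using d(2)[of x] that by (simp add: \<rho>_def dist_commute)
  obtain M where M: "M-lipschitz_on (cball a e) f"
    using C1_imp_lipschitz_on_cball[OF C2_imp_C1[OF f(1)] e(2)] .
  obtain K where K0: "K \<ge> 0" and K:
    "\<And>x y t. x \<in> cball a e \<Longrightarrow> y \<in> cball a e \<Longrightarrow> 0 \<le> t \<Longrightarrow> t \<le> 1 \<Longrightarrow>
      norm (f ((1 - t) *\<^sub>R x + t *\<^sub>R y) - ((1 - t) *\<^sub>R f x + t *\<^sub>R f y))
        \<le> K * (t * (1 - t) * (norm (x - y))\<^sup>2)"
    using C2_convex_combination_defect[OF f(1) e(2)] by blast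
  \<comment> \<open>\<open>2 * L * K\<close> pays for moving \<open>f z\<close> to the chord, \<open>\<kappa> * M\<^sup>2\<close> for the semiconvexity error of \<open>u\<close>.\<close>
  define \<mu> where "\<mu> = 2 * L * K + \<kappa> * M\<^sup>2"
  have "convex_on (ball a \<rho>) (\<lambda>x. (u \<circ> f) x + \<mu> / 2 * (norm x)\<^sup>2)"
    unfolding convex_on_add_norm_sq_iff o_def
  proof (intro conjI ballI allI impI)
    fix x y and t :: real
    assume x: "x \<in> ball a \<rho>" and y: "y \<in> ball a \<rho>" and t: "0 \<le> t" "t \<le> 1"
    define z where "z = (1 - t) *\<^sub>R x + t *\<^sub>R y"
    define q where "q = (1 - t) *\<^sub>R f x + t *\<^sub>R f y"
    let ?Q = "t * (1 - t) * (norm (x - y))\<^sup>2"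
    have z: "z \<in> ball a \<rho>"
      unfolding z_def using convexD_alt[OF convex_ball x y t] .
    have q: "q \<in> ball (f a) s"
      unfolding q_def using convexD_alt[OF convex_ball f_ball[OF x] f_ball[OF y] t] .
    have xe: "x \<in> cball a e" and ye: "y \<in> cball a e"
      using x y \<rho>(2) by blast+
    have "u (f z) - u q \<le> L * norm (f z - q)"
      using lipschitz_on_normD[OF L f_ball[OF z] q] by (simp add: abs_le_iff)
    also have "\<dots> \<le> L * (K * ?Q)"
      unfolding z_def q_def using K[OF xe ye t] L0 by (intro mult_left_mono)
    finally have 1: "u (f z) \<le> u q + L * (K * ?Q)"
      by simp
    have 2: "u q \<le> (1 - t) * u (f x) + t * u (f y) + \<kappa> / 2 * (t * (1 - t) * (norm (f x - f y))\<^sup>2)"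
      unfolding q_def
      using conv f_ball[OF x] f_ball[OF y] s(2) t unfolding convex_on_add_norm_sq_iff by blast
    have "(norm (f x - f y))\<^sup>2 \<le> M\<^sup>2 * (norm (x - y))\<^sup>2"
      using power_mono[OF lipschitz_on_normD[OF M xe ye], of 2] by (simp add: power_mult_distrib)
    then have 3: "\<kappa> / 2 * (t * (1 - t) * (norm (f x - f y))\<^sup>2)
        \<le> \<kappa> / 2 * (t * (1 - t) * (M\<^sup>2 * (norm (x - y))\<^sup>2))"
      using \<kappa> t by (intro mult_left_mono) auto
    have "L * (K * ?Q) + \<kappa> / 2 * (t * (1 - t) * (M\<^sup>2 * (norm (x - y))\<^sup>2)) = \<mu> / 2 * ?Q"
      by (simp add: \<mu>_def field_simps)
    with 1 2 3 show "u (f ((1 - t) *\<^sub>R x + t *\<^sub>R y))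
        \<le> (1 - t) * u (f x) + t * u (f y) + \<mu> / 2 * ?Q"
      unfolding z_def by linarith
  qed simp
  moreover have "\<mu> \<ge> 0"
    using L0 K0 \<kappa> by (simp add: \<mu>_def)
  moreover have "a \<in> ball a \<rho>" "ball a \<rho> \<subseteq> X"
    using d e by (auto simp: \<rho>_def)
  ultimately show "\<exists>c r. a \<in> ball c r \<and> ball c r \<subseteq> X \<and>
      (\<exists>\<kappa>\<ge>0. convex_on (ball c r) (\<lambda>x. (u \<circ> f) x + \<kappa> / 2 * (norm x)\<^sup>2))"
    by blast
qed

theorem theorem10p1:
  fixes \<Phi> :: "real ^ 'n \<Rightarrow> real ^ 'n"
    and X Y :: "(real ^ 'n) set"
    and u :: "real ^ 'n \<Rightarrow> real"
  assumes "open X" and "open Y"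
    and "smooth_diffeomorphism X Y \<Phi>"
    and "locally_semiconvex_on Y u"
  shows "locally_semiconvex_on X (u \<circ> \<Phi>)"
proof (rule locally_semiconvex_on_compose_C2)
  show "C_k_on (Suc (Suc 0)) \<Phi> X" "\<Phi> ` X \<subseteq> Y"
    using assms(3) unfolding smooth_diffeomorphism_def smooth_on_def bij_betw_def by blast+
qed (use assms in auto)

end
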